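(* Let $X$ be a real Hilbert space with inner product $(\cdot,\cdot)_X$ and norm $\|\cdot\|_X$. Assume: (i) $K\subset X$ is nonempty, closed and convex; (ii) $A:X\to X$ is strongly monotone and Lipschitz continuous, i.e. there exist $m>0$ and $M>0$ such that $(Au-Av,u-v)_X\ge m\|u-v\|_X^2$ and $\|Au-Av\|_X\le M\|u-v\|_X$ for all $u,v\in X$; (iii) $j:X\to\mathbb{R}$ is convex, and for each $D>0$ there exists $L_D>0$ such that $|j(u)-j(v)|\le L_D\|u-v\|_X$ for all $u,v\in X$ with $\|u\|_X\le D$ and $\|v\|_X\le D$; (iv) $f\in X$. Let $u$ be the unique solution of the variational inequality $$u\in K,\qquad (Au,v-u)_X+j(v)-j(u)\ge (f,v-u)_X\quad\forall\, v\in K,$$ and let $\{u_n\}_{n\in\mathbb{N}}\subset X$ be an arbitrary sequence. Then the following two statements are equivalent: (1) $u_n\to u$ strongly in $X$. (2) Both of the following hold: (a) $d(u_n,K)\to 0$; (b) there exists a sequence of real numbers $\varepsilon_n\ge 0$ with $\varepsilon_n\to 0$ such that $$(Au_n,v-u_n)_X+j(v)-j(u_n)+\varepsilon_n\bigl(1+\|v-u_n\|_X\bigr)\ge (f,v-u_n)_X\quad\forall\, v\in K,\ n\in\mathbb{N}.$$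
   Context: $d(w,K)=\inf_{v\in K}\|w-v\|_X$ for $w\in X$. Under assumptions (i)--(iv) it is a known result that the variational inequality has a unique solution $u$. *)

theory Defs
  imports "HOL-Analysis.Analysis"
begin

definition strongly_monotone :: "real \<Rightarrow> ('a::real_inner \<Rightarrow> 'a) \<Rightarrow> bool" where
  "strongly_monotone m A \<longleftrightarrow>
     (\<forall>u v. (A u - A v) \<bullet> (u - v) \<ge> m * (norm (u - v))\<^sup>2)"

definition solves_VI ::
  "'a::real_inner set \<Rightarrow> ('a \<Rightarrow> 'a) \<Rightarrow> ('a \<Rightarrow> real) \<Rightarrow> 'a \<Rightarrow> 'a \<Rightarrow> bool" where
  "solves_VI K A j f u \<longleftrightarrow>
     u \<in> K \<and> (\<forall>v\<in>K. A u \<bullet> (v - u) + j v - j u \<ge> f \<bullet> (v - u))"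

end

theory Submission
  imports Defs
begin

text \<open>
  Both directions compare the perturbed inequality at an arbitrary point \<open>w\<close> with the exact
  inequality at \<open>u\<close>.

  If \<open>w\<close> is near \<open>u\<close>, then replacing \<open>u\<close> by \<open>w\<close> in the variational inequality costs at most
  \<open>(M + norm (A u) + norm f) * norm (w - u) + \<bar>j w - j u\<bar>\<close>, up to the weight \<open>1 + norm (v - w)\<close>
  (\<open>solves_VI_residual\<close>). This quantity is the required \<open>\<epsilon>\<close>, and it vanishes in the limit because
  \<open>j\<close> is continuous.

  Conversely, adding the perturbed inequality at \<open>w\<close>, tested with \<open>u\<close>, to strong monotonicity gives
  \<open>m * (norm (w - u))\<^sup>2 \<le> (A u - f) \<bullet> (u - w) + j u - j w + \<epsilon> * (1 + norm (w - u))\<close>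
  (\<open>strongly_monotone_energy_bound\<close>). This is used twice. A convex function that is Lipschitz near
  \<open>u\<close> decreases at most linearly away from \<open>u\<close> (\<open>convex_on_decrease_le\<close>), so the right-hand side
  grows at most linearly in \<open>norm (w - u)\<close>, and the sequence is bounded. Once everything stays
  in one ball, \<open>j\<close> has a single Lipschitz constant there. The exact inequality at \<open>u\<close>,
  tested with a point \<open>p \<in> K\<close> close to \<open>w\<close>, then replaces \<open>u\<close> by \<open>p\<close> on the right-hand side, which
  becomes a multiple of \<open>norm (p - w)\<close> plus a multiple of \<open>\<epsilon>\<close>; both tend to zero.
\<close>

section \<open>Linear lower bound and continuity of the convex term\<close>

text \<open>
  If \<open>w\<close> is far away, the point at distance one from \<open>u\<close> on the segment towards \<open>w\<close> lies in the ball
  where the Lipschitz bound is available; by convexity the slope of \<open>j\<close> along the ray can only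
  increase beyond that point.
\<close>
lemma convex_on_decrease_le:
  fixes j :: "'a::real_normed_vector \<Rightarrow> real"
  assumes conv: "convex_on UNIV j" and lip: "L-lipschitz_on (cball u 1) j"
  shows "j u - j w \<le> L * norm (w - u)"
proof (cases "norm (w - u) \<le> 1")
  case True
  then have "dist (j u) (j w) \<le> L * dist u w"
    by (intro lipschitz_onD[OF lip]) (auto simp: dist_norm norm_minus_commute)
  then show ?thesis by (simp add: dist_norm norm_minus_commute)
next
  case False
  define t where "t = norm (w - u)"
  have t: "t > 1" using False by (simp add: t_def)
  define p where "p = (1 - 1 / t) *\<^sub>R u + (1 / t) *\<^sub>R w"
  have "u - p = (1 / t) *\<^sub>R (u - w)"
    by (simp add: p_def algebra_simps)
  then have d: "dist u p = 1"
    using t by (auto simp: dist_norm t_def norm_minus_commute)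
  have "dist (j u) (j p) \<le> L * dist u p"
    by (intro lipschitz_onD[OF lip]) (use d in auto)
  then have "j u - j p \<le> L"
    using d by (simp add: dist_norm)
  moreover have "j p \<le> (1 - 1 / t) * j u + (1 / t) * j w"
    using convex_onD[OF conv, of "1 / t" u w] t by (simp add: p_def)
  ultimately have "(1 / t) * (j u - j w) \<le> L"
    by (simp add: algebra_simps)
  then show ?thesis
    using t by (simp add: t_def[symmetric] field_simps)
qed

lemma locally_lipschitz_isCont:
  fixes j :: "'a::real_normed_vector \<Rightarrow> 'b::metric_space"
  assumes "\<forall>D>0. \<exists>L>0. L-lipschitz_on {w. norm w \<le> D} j"
  shows "isCont j u"
proof -
  have "norm u + 1 > 0" by (simp add: add_nonneg_pos)
  then obtain L where "L-lipschitz_on {w. norm w \<le> norm u + 1} j"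
    using assms by blast
  then have "L-lipschitz_on (ball 0 (norm u + 1)) j"
    by (rule lipschitz_on_subset) auto
  then have "continuous_on (ball 0 (norm u + 1)) j"
    by (rule lipschitz_on_continuous_on)
  then have "\<forall>x\<in>ball 0 (norm u + 1). isCont j x"
    unfolding continuous_on_eq_continuous_at[OF open_ball] .
  moreover have "u \<in> ball 0 (norm u + 1)" by simp
  ultimately show ?thesis ..
qed

section \<open>Residual of the exact inequality at nearby points\<close>

text \<open>
  Moving the base point of the inequality from \<open>u\<close> to \<open>w\<close> produces the term
  \<open>(A w - A u) \<bullet> (v - w)\<close>, the only one that grows with the test point \<open>v\<close>, and linearly so, which
  the weight \<open>1 + norm (v - w)\<close> absorbs, and terms that depend on \<open>w\<close> alone.
\<close>
lemma solves_VI_residual: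
  fixes A :: "'a::real_inner \<Rightarrow> 'a"
  assumes sol: "solves_VI K A j f u" and lip: "M-lipschitz_on UNIV A" and v: "v \<in> K"
  shows "A w \<bullet> (v - w) + j v - j w
      + ((M + norm (A u) + norm f) * norm (w - u) + \<bar>j w - j u\<bar>) * (1 + norm (v - w))
      \<ge> f \<bullet> (v - w)"
proof -
  have vi: "A u \<bullet> (v - u) + j v - j u \<ge> f \<bullet> (v - u)"
    using sol v by (simp add: solves_VI_def)
  have M: "M \<ge> 0"
    using lip by (rule lipschitz_on_nonneg)
  have "norm (A w - A u) \<le> M * norm (w - u)"
    using lipschitz_onD[OF lip, of w u] by (simp add: dist_norm)
  then have "norm (A w - A u) * norm (v - w) \<le> (M * norm (w - u)) * norm (v - w)"
    by (rule mult_right_mono) simp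
  then have 1: "- ((A w - A u) \<bullet> (v - w)) \<le> M * norm (w - u) * norm (v - w)"
    using Cauchy_Schwarz_ineq2[of "A w - A u" "v - w"] by linarith
  have 2: "A u \<bullet> (w - u) \<le> norm (A u) * norm (w - u)" "f \<bullet> (u - w) \<le> norm f * norm (w - u)"
    using norm_cauchy_schwarz[of "A u" "w - u"] norm_cauchy_schwarz[of f "u - w"]
    by (simp_all add: norm_minus_commute)
  have "f \<bullet> (v - w) - (A w \<bullet> (v - w) + j v - j w)
      \<le> - ((A w - A u) \<bullet> (v - w)) + A u \<bullet> (w - u) + f \<bullet> (u - w) + (j w - j u)"
    using vi by (simp add: inner_diff_left inner_diff_right)
  also have "\<dots> \<le> M * norm (w - u) * norm (v - w)
      + (norm (A u) * norm (w - u) + norm f * norm (w - u) + \<bar>j w - j u\<bar>)"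
    using 1 2 by linarith
  also have "\<dots> \<le> ((M + norm (A u) + norm f) * norm (w - u) + \<bar>j w - j u\<bar>) * (1 + norm (v - w))"
  proof -
    have "0 \<le> M * norm (w - u)
        + (norm (A u) * norm (w - u) + norm f * norm (w - u) + \<bar>j w - j u\<bar>) * norm (v - w)"
      using M by simp
    then show ?thesis by (simp add: algebra_simps)
  qed
  finally show ?thesis by simp
qed

section \<open>Error estimates for approximate solutions\<close>

lemma strongly_monotone_energy_bound:
  assumes mono: "strongly_monotone m A"
    and test: "A w \<bullet> (u - w) + j u - j w + e * (1 + norm (u - w)) \<ge> f \<bullet> (u - w)"
  shows "m * (norm (w - u))\<^sup>2 \<le> (A u - f) \<bullet> (u - w) + j u - j w + e * (1 + norm (w - u))"
proof -
  have "m * (norm (w - u))\<^sup>2 \<le> (A w - A u) \<bullet> (w - u)"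
    using mono by (simp add: strongly_monotone_def)
  also have "\<dots> = A u \<bullet> (u - w) - A w \<bullet> (u - w)"
    by (simp add: inner_diff_left inner_diff_right)
  finally show ?thesis
    using test by (simp add: inner_diff_left norm_minus_commute)
qed

lemma norm_le_of_quadratic_le:
  fixes t m c e :: real
  assumes "m > 0" "c \<ge> 0" "e \<ge> 0" "m * t\<^sup>2 \<le> c * t + e"
  shows "t \<le> 1 + (c + e) / m"
proof (cases "t \<le> 1")
  case True
  with assms show ?thesis by (smt (verit) divide_nonneg_pos)
next
  case False
  then have "e \<le> e * t" using assms by (simp add: mult_le_cancel_left1)
  then have "t * (m * t) \<le> t * (c + e)"
    using assms by (simp add: power2_eq_square algebra_simps)
  then have "m * t \<le> c + e" using False by simp
  then show ?thesis using assms by (simp add: field_simps)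
qed

text \<open>
  This a priori bound must use only a Lipschitz constant of \<open>j\<close> near the fixed point \<open>u\<close>: a constant
  valid at \<open>w\<close> is available only once \<open>w\<close> is known to lie in a fixed ball.
\<close>
lemma perturbed_VI_bounded:
  fixes A :: "'a::real_inner \<Rightarrow> 'a"
  assumes mono: "strongly_monotone m A" and m: "m > 0"
    and conv: "convex_on UNIV j" and lip: "L-lipschitz_on (cball u 1) j"
    and e: "0 \<le> e" "e \<le> E"
    and test: "A w \<bullet> (u - w) + j u - j w + e * (1 + norm (u - w)) \<ge> f \<bullet> (u - w)"
  shows "norm (w - u) \<le> 1 + (norm (A u - f) + L + 2 * E) / m"
proof -
  have "m * (norm (w - u))\<^sup>2 \<le> (A u - f) \<bullet> (u - w) + (j u - j w) + e * (1 + norm (w - u))"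
    using strongly_monotone_energy_bound[OF mono test] by simp
  also have "\<dots> \<le> norm (A u - f) * norm (w - u) + L * norm (w - u) + E * (1 + norm (w - u))"
  proof (intro add_mono)
    show "(A u - f) \<bullet> (u - w) \<le> norm (A u - f) * norm (w - u)"
      using norm_cauchy_schwarz[of "A u - f" "u - w"] by (simp add: norm_minus_commute)
    show "j u - j w \<le> L * norm (w - u)"
      by (rule convex_on_decrease_le[OF conv lip])
    show "e * (1 + norm (w - u)) \<le> E * (1 + norm (w - u))"
      using e by (intro mult_right_mono) auto
  qed
  finally have "m * (norm (w - u))\<^sup>2 \<le> (norm (A u - f) + L + E) * norm (w - u) + E"
    by (simp add: algebra_simps)
  moreover have "L \<ge> 0" using lip by (rule lipschitz_on_nonneg)
  ultimately have "norm (w - u) \<le> 1 + ((norm (A u - f) + L + E) + E) / m"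
    using m e by (intro norm_le_of_quadratic_le) auto
  then show ?thesis by (simp add: add_ac)
qed

text \<open>
  The exact inequality at \<open>u\<close> bounds \<open>(A u - f) \<bullet> (u - p) + j u - j p\<close> by zero, which lets the
  admissible point \<open>p\<close> take the place of \<open>u\<close> in the energy bound.
\<close>
lemma perturbed_VI_error_estimate:
  fixes A :: "'a::real_inner \<Rightarrow> 'a"
  assumes mono: "strongly_monotone m A" and sol: "solves_VI K A j f u"
    and lip: "L-lipschitz_on B j" and p: "p \<in> K" "p \<in> B" and w: "w \<in> B"
    and test: "A w \<bullet> (u - w) + j u - j w + e * (1 + norm (u - w)) \<ge> f \<bullet> (u - w)"
  shows "m * (norm (w - u))\<^sup>2 \<le> (norm (A u - f) + L) * dist w p + e * (1 + norm (w - u))"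
proof -
  have "A u \<bullet> (p - u) + j p - j u \<ge> f \<bullet> (p - u)"
    using sol p by (simp add: solves_VI_def)
  then have "(A u - f) \<bullet> (u - w) + j u - j w \<le> (A u - f) \<bullet> (p - w) + (j p - j w)"
    by (simp add: inner_diff_left inner_diff_right)
  also have "\<dots> \<le> norm (A u - f) * dist w p + L * dist w p"
  proof (intro add_mono)
    show "(A u - f) \<bullet> (p - w) \<le> norm (A u - f) * dist w p"
      using norm_cauchy_schwarz[of "A u - f" "p - w"] by (simp add: dist_norm norm_minus_commute)
    show "j p - j w \<le> L * dist w p"
      using lipschitz_onD[OF lip w p(2)] by (simp add: dist_norm)
  qed
  finally show ?thesis
    using strongly_monotone_energy_bound[OF mono test] by (simp add: algebra_simps)
qed

lemma convergent_real_seq_bounded_above: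
  fixes a :: "nat \<Rightarrow> real"
  assumes "a \<longlonglongrightarrow> l"
  shows "\<exists>C. \<forall>n. a n \<le> C"
proof -
  have "bounded (range a)"
    using assms by (rule convergent_imp_bounded)
  then have "bdd_above (range a)"
    by (rule bounded_imp_bdd_above)
  then show ?thesis by (auto simp: bdd_above_def)
qed

lemma perturbed_VI_convergence:
  fixes A :: "'a::real_inner \<Rightarrow> 'a" and U :: "nat \<Rightarrow> 'a"
  assumes mono: "strongly_monotone m A" and m: "m > 0"
    and conv: "convex_on UNIV j"
    and lip: "\<forall>D>0. \<exists>L>0. L-lipschitz_on {w. norm w \<le> D} j"
    and sol: "solves_VI K A j f u"
    and dist0: "(\<lambda>n. infdist (U n) K) \<longlonglongrightarrow> 0"
    and e: "\<And>n. e n \<ge> 0" "e \<longlonglongrightarrow> 0"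
    and test: "\<And>n. A (U n) \<bullet> (u - U n) + j u - j (U n) + e n * (1 + norm (u - U n))
                 \<ge> f \<bullet> (u - U n)"
  shows "U \<longlonglongrightarrow> u"
proof -
  obtain E where E: "\<And>n. e n \<le> E"
    using convergent_real_seq_bounded_above[OF e(2)] by blast
  have "norm u + 1 > 0" by (simp add: add_nonneg_pos)
  then obtain L1 where "L1-lipschitz_on {w. norm w \<le> norm u + 1} j"
    using lip by blast
  then have L1: "L1-lipschitz_on (cball u 1) j"
  proof (rule lipschitz_on_subset)
    show "cball u 1 \<subseteq> {w. norm w \<le> norm u + 1}"
    proof
      fix w assume "w \<in> cball u 1"
      then show "w \<in> {w. norm w \<le> norm u + 1}"
        using norm_triangle_sub[of w u] by (auto simp: dist_norm norm_minus_commute)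
    qed
  qed
  define T where "T = 1 + (norm (A u - f) + L1 + 2 * E) / m"
  have T: "norm (U n - u) \<le> T" for n
    unfolding T_def by (rule perturbed_VI_bounded[OF mono m conv L1 e(1) E test])
  have T0: "T \<ge> 0" using T[of 0] norm_ge_zero order_trans by blast

  \<comment> \<open>Nearest points are replaced by almost nearest ones, with an error that vanishes.\<close>
  define \<delta> where "\<delta> n = infdist (U n) K + inverse (real (Suc n))" for n
  have \<delta>0: "\<delta> \<longlonglongrightarrow> 0"
    using tendsto_add[OF dist0 LIMSEQ_inverse_real_of_nat] by (simp add: \<delta>_def[abs_def])
  have "\<exists>p\<in>K. dist (U n) p < \<delta> n" for n
  proof -
    have "infdist (U n) K < \<delta> n" by (simp add: \<delta>_def)
    moreover have "K \<noteq> {}" using sol by (auto simp: solves_VI_def)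
    ultimately show ?thesis
      by (auto simp: infdist_notempty cINF_less_iff)
  qed
  then obtain p where p: "\<And>n. p n \<in> K" "\<And>n. dist (U n) (p n) < \<delta> n"
    by metis
  obtain F where F: "\<And>n. \<delta> n \<le> F"
    using convergent_real_seq_bounded_above[OF \<delta>0] by blast
  have F0: "F \<ge> 0"
    using p(2)[of 0] F[of 0] zero_le_dist[of "U 0" "p 0"] by linarith

  define D where "D = norm u + T + F + 1"
  have D: "D > 0" using T0 F0 norm_ge_zero[of u] unfolding D_def by linarith
  then obtain L where L: "L-lipschitz_on {w. norm w \<le> D} j" using lip by blast
  have U_in: "U n \<in> {w. norm w \<le> D}" for n
    using norm_triangle_sub[of "U n" u] T[of n] F0 by (simp add: D_def)
  have p_in: "p n \<in> {w. norm w \<le> D}" for n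
    using norm_triangle_sub[of "U n" u] norm_triangle_sub[of "p n" "U n"] T[of n] p(2)[of n] F[of n]
    by (simp add: D_def dist_norm norm_minus_commute)
  have L0: "L \<ge> 0" using L by (rule lipschitz_on_nonneg)

  have bound: "m * (norm (U n - u))\<^sup>2 \<le> (norm (A u - f) + L) * \<delta> n + e n * (1 + T)" for n
  proof -
    have "m * (norm (U n - u))\<^sup>2
        \<le> (norm (A u - f) + L) * dist (U n) (p n) + e n * (1 + norm (U n - u))"
      by (rule perturbed_VI_error_estimate[OF mono sol L p(1) p_in U_in test])
    also have "\<dots> \<le> (norm (A u - f) + L) * \<delta> n + e n * (1 + T)"
      using less_imp_le[OF p(2)] L0 e(1) T by (intro add_mono mult_left_mono) auto
    finally show ?thesis .
  qed
  have "(\<lambda>n. (norm (A u - f) + L) * \<delta> n + e n * (1 + T)) \<longlonglongrightarrow> 0"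
    using tendsto_add[OF tendsto_mult_left[OF \<delta>0] tendsto_mult_right[OF e(2)]] by simp
  then have "(\<lambda>n. m * (norm (U n - u))\<^sup>2) \<longlonglongrightarrow> 0"
    by (rule tendsto_sandwich[OF _ _ tendsto_const, rotated 2])
      (use m bound in \<open>auto intro!: always_eventually\<close>)
  then have "(\<lambda>n. inverse m * (m * (norm (U n - u))\<^sup>2)) \<longlonglongrightarrow> inverse m * 0"
    by (rule tendsto_mult_left)
  then have "(\<lambda>n. (norm (U n - u))\<^sup>2) \<longlonglongrightarrow> 0"
    using m by (simp add: mult.assoc[symmetric])
  from tendsto_real_sqrt[OF this] have "(\<lambda>n. norm (U n - u)) \<longlonglongrightarrow> 0"
    by simp
  then show ?thesis
    by (simp add: LIM_zero_iff tendsto_norm_zero_iff)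
qed

section \<open>Characterization of convergence to the solution\<close>

theorem theorem8:
  fixes K :: "'a::{real_inner, complete_space} set"
    and A :: "'a \<Rightarrow> 'a"
    and j :: "'a \<Rightarrow> real"
    and f u :: 'a
    and U :: "nat \<Rightarrow> 'a"
  assumes "K \<noteq> {}" and "closed K" and "convex K"
    and "\<exists>m>0. strongly_monotone m A"
    and "\<exists>M>0. M-lipschitz_on UNIV A"
    and "convex_on UNIV j"
    and "\<forall>D>0. \<exists>L>0. L-lipschitz_on {w. norm w \<le> D} j"
    and "solves_VI K A j f u"
  shows "U \<longlonglongrightarrow> u \<longleftrightarrow>
    (\<lambda>n. infdist (U n) K) \<longlonglongrightarrow> 0 \<and>
    (\<exists>\<epsilon> :: nat \<Rightarrow> real. (\<forall>n. \<epsilon> n \<ge> 0) \<and> \<epsilon> \<longlonglongrightarrow> 0 \<and>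
      (\<forall>n. \<forall>v\<in>K. A (U n) \<bullet> (v - U n) + j v - j (U n)
                    + \<epsilon> n * (1 + norm (v - U n)) \<ge> f \<bullet> (v - U n)))"
    (is "_ \<longleftrightarrow> ?dist \<and> (\<exists>\<epsilon>. ?perturbed \<epsilon>)")
proof -
  have uK: "u \<in> K" using assms(8) by (simp add: solves_VI_def)
  show ?thesis
  proof
    assume lim: "U \<longlonglongrightarrow> u"
    have ?dist
      using tendsto_infdist[OF lim, of K] uK by simp
    obtain M where M: "M > 0" "M-lipschitz_on UNIV A" using assms(5) by blast
    define \<epsilon> where
      "\<epsilon> n = (M + norm (A u) + norm f) * norm (U n - u) + \<bar>j (U n) - j u\<bar>" for n
    have "(\<lambda>n. j (U n)) \<longlonglongrightarrow> j u"
      using isCont_tendsto_compose[OF locally_lipschitz_isCont[OF assms(7)] lim] .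
    then have "(\<lambda>n. \<bar>j (U n) - j u\<bar>) \<longlonglongrightarrow> 0"
      by (simp add: LIM_zero_iff tendsto_rabs_zero_iff)
    moreover have "(\<lambda>n. norm (U n - u)) \<longlonglongrightarrow> 0"
      using lim by (simp add: LIM_zero_iff tendsto_norm_zero_iff)
    ultimately have "\<epsilon> \<longlonglongrightarrow> 0"
      unfolding \<epsilon>_def[abs_def] by (auto intro: tendsto_add_zero tendsto_mult_right_zero)
    moreover have "\<epsilon> n \<ge> 0" for n using M(1) by (simp add: \<epsilon>_def)
    ultimately have "?perturbed \<epsilon>"
      unfolding \<epsilon>_def using solves_VI_residual[OF assms(8) M(2)] by blast
    then have "\<exists>\<epsilon>. ?perturbed \<epsilon>"
      by (rule exI[of "?perturbed" \<epsilon>])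
    with \<open>?dist\<close> show "?dist \<and> (\<exists>\<epsilon>. ?perturbed \<epsilon>)" ..
  next
    assume "?dist \<and> (\<exists>\<epsilon>. ?perturbed \<epsilon>)"
    then obtain \<epsilon> where "?dist" "?perturbed \<epsilon>" by blast
    moreover obtain m where "m > 0" "strongly_monotone m A" using assms(4) by blast
    ultimately show "U \<longlonglongrightarrow> u"
      using perturbed_VI_convergence[OF _ _ assms(6-8), where m = m and e = \<epsilon>] uK by blast
  qed
qed

end
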